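(* Let $w \in \mathbb{N}^*$. Let $\mathrm{supp}(w) = \{x_1 < \dots < x_k\}$ and let $A_1,\dots,A_l$ be all the intervals of $\mathrm{supp}(w)$ such that $A_j$ only contains simple letters of $w$ and $A_j \cup \{a\}$ is not an interval of $\mathrm{supp}(w)$ for any simple letter $a \notin A_j$ of $w$. Let $h(w[A_j])$ be the size of the hypoplactic class of $w[A_j]$. Then there are $$\frac{|w|!}{\prod_{i=1}^{k}|w|_{x_i}!} \prod_{j=1}^{l} \frac{h(w[A_j])}{|A_j|!}$$ words over $\mathbb{N}$ in the $\equiv_{\mathrm{jTg}}$-class of $w$.
   Context: $\mathbb{N}=\{1,2,\dots\}$ with its usual order and $\mathbb{N}^*$ is the free monoid of words over $\mathbb{N}$. For a word $w$: $|w|$ is its length; $|w|_x$ is the number of occurrences of $x$ in $w$; $\mathrm{supp}(w)$ is the set of letters occurring in $w$; a letter $x$ is simple in $w$ if $|w|_x=1$; for a set $S$ of letters, $w[S]$ is the word obtained from $w$ by deleting all letters not in $S$. An interval of $\mathrm{supp}(w)$ is a (nonempty) set of consecutive elements of the finite totally ordered set $\mathrm{supp}(w)$; thus the $A_j$ are the maximal intervals of $\mathrm{supp}(w)$ consisting of simple letters. Define the following sets of pairs (with $a,b,c\in\mathbb{N}$, $u\in\mathbb{N}^*$): $\mathcal{R}_{\mathrm{sylv}}=\{(ca\,u\,b,\ ac\,u\,b): a\le b<c\}$, $\mathcal{R}_{\mathrm{sylv}^\#}=\{(b\,u\,ac,\ b\,u\,ca): a<b\le c\}$, $\mathcal{R}_{\mathrm{rSt}}=\{(ba\,u\,b,\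 ab\,u\,b)\}$, $\mathcal{R}_{\mathrm{lSt}}=\{(b\,u\,ab,\ b\,u\,ba)\}$. The hypoplactic congruence is the congruence on $\mathbb{N}^*$ generated by $\mathcal{R}_{\mathrm{sylv}}\cup\mathcal{R}_{\mathrm{sylv}^\#}$, and the hypoplactic class of a word is its class under this congruence. The join-taiga congruence $\equiv_{\mathrm{jTg}}$ is the join of the right-taiga congruence (generated by $\mathcal{R}_{\mathrm{sylv}}\cup\mathcal{R}_{\mathrm{rSt}}$) and the left-taiga congruence (generated by $\mathcal{R}_{\mathrm{sylv}^\#}\cup\mathcal{R}_{\mathrm{lSt}}$), i.e. the congruence generated by the union of all four sets. *)

theory Defs
  imports Complex_Main
begin

text \<open>The alphabet consists of the positive natural numbers. Since \<open>0 :: nat\<close> is not a letter, words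
  are the members of a subset of \<^typ>\<open>nat list\<close>, and all relations below live on that subset.\<close>

definition words :: "nat list set" where
  "words = lists {1..}"

definition is_congruence :: "(nat list \<times> nat list) set \<Rightarrow> bool" where
  "is_congruence r \<longleftrightarrow> equiv words r \<and>
     (\<forall>(u, v) \<in> r. \<forall>p \<in> words. \<forall>q \<in> words. (p @ u @ q, p @ v @ q) \<in> r)"

definition generated_congruence :: "(nat list \<times> nat list) set \<Rightarrow> (nat list \<times> nat list) set" where
  "generated_congruence R = \<Inter> {r. is_congruence r \<and> R \<subseteq> r}"

definition R_sylv :: "(nat list \<times> nat list) set" where
  "R_sylv = {([c, a] @ u @ [b], [a, c] @ u @ [b]) | a b c u.
     1 \<le> a \<and> a \<le> b \<and> b < c \<and> u \<in> words}"

definition R_sylv_sharp :: "(nat list \<times> nat list) set" where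
  "R_sylv_sharp = {([b] @ u @ [a, c], [b] @ u @ [c, a]) | a b c u.
     1 \<le> a \<and> a < b \<and> b \<le> c \<and> u \<in> words}"

definition R_rSt :: "(nat list \<times> nat list) set" where
  "R_rSt = {([b, a] @ u @ [b], [a, b] @ u @ [b]) | a b u.
     1 \<le> a \<and> 1 \<le> b \<and> u \<in> words}"

definition R_lSt :: "(nat list \<times> nat list) set" where
  "R_lSt = {([b] @ u @ [a, b], [b] @ u @ [b, a]) | a b u.
     1 \<le> a \<and> 1 \<le> b \<and> u \<in> words}"

definition hypoplactic :: "(nat list \<times> nat list) set" where
  "hypoplactic = generated_congruence (R_sylv \<union> R_sylv_sharp)"

definition right_taiga :: "(nat list \<times> nat list) set" where
  "right_taiga = generated_congruence (R_sylv \<union> R_rSt)"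

definition left_taiga :: "(nat list \<times> nat list) set" where
  "left_taiga = generated_congruence (R_sylv_sharp \<union> R_lSt)"

text \<open>The join in the lattice of congruences; lemma \<open>join_taiga_eq\<close> below gives the presentation by
  the union of the four sets of pairs.\<close>

definition join_taiga :: "(nat list \<times> nat list) set" where
  "join_taiga = generated_congruence (right_taiga \<union> left_taiga)"

definition simple_letters :: "nat list \<Rightarrow> nat set" where
  "simple_letters w = {x. count_list w x = 1}"

definition restrict_word :: "nat list \<Rightarrow> nat set \<Rightarrow> nat list" where
  "restrict_word w S = filter (\<lambda>x. x \<in> S) w"

text \<open>Consecutive is meant relative to the support: \<open>{1, 3}\<close> is an interval of \<open>{1, 3, 4}\<close>.\<close>

definition is_interval_of :: "nat set \<Rightarrow> nat set \<Rightarrow> bool" where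
  "is_interval_of X I \<longleftrightarrow> I \<noteq> {} \<and> I \<subseteq> X \<and>
     (\<forall>x \<in> I. \<forall>z \<in> I. \<forall>y \<in> X. x \<le> y \<and> y \<le> z \<longrightarrow> y \<in> I)"

definition max_simple_intervals :: "nat list \<Rightarrow> nat set set" where
  "max_simple_intervals w = {A. is_interval_of (set w) A \<and> A \<subseteq> simple_letters w \<and>
     (\<forall>a \<in> simple_letters w. a \<notin> A \<longrightarrow> \<not> is_interval_of (set w) (A \<union> {a}))}"

definition hypoplactic_class_size :: "nat list \<Rightarrow> nat" where
  "hypoplactic_class_size w = card (hypoplactic `` {w})"

lemma generated_congruence_superset: "R \<subseteq> generated_congruence R"
  by (auto simp: generated_congruence_def)

lemma generated_congruence_least:
  "is_congruence r \<Longrightarrow> R \<subseteq> r \<Longrightarrow> generated_congruence R \<subseteq> r"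
  by (auto simp: generated_congruence_def)

lemma is_congruence_generated_congruence:
  assumes "R \<subseteq> words \<times> words"
  shows "is_congruence (generated_congruence R)"
proof -
  have top: "is_congruence (words \<times> words)"
    by (auto simp: is_congruence_def equiv_def refl_on_def sym_def trans_def words_def)
  have sub: "generated_congruence R \<subseteq> words \<times> words"
    by (rule generated_congruence_least[OF top assms])
  have "refl_on words (generated_congruence R)"
    by (auto simp: generated_congruence_def is_congruence_def equiv_def refl_on_def)
  moreover have "sym (generated_congruence R)"
    unfolding generated_congruence_def
    by (rule sym_INTER[of "{r. is_congruence r \<and> R \<subseteq> r}" id, simplified])
      (simp add: is_congruence_def equiv_def)
  moreover have "trans (generated_congruence R)"
    unfolding generated_congruence_def
    by (rule trans_INTER[of "{r. is_congruence r \<and> R \<subseteq> r}" id, simplified])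
      (simp add: is_congruence_def equiv_def)
  moreover have "\<forall>(u, v) \<in> generated_congruence R. \<forall>p \<in> words. \<forall>q \<in> words.
      (p @ u @ q, p @ v @ q) \<in> generated_congruence R"
  proof (intro ballI, clarify)
    fix u v p q
    assume "(u, v) \<in> generated_congruence R" "p \<in> words" "q \<in> words"
    then show "(p @ u @ q, p @ v @ q) \<in> generated_congruence R"
      unfolding generated_congruence_def is_congruence_def by fast
  qed
  ultimately show ?thesis
    using sub by (simp add: is_congruence_def equiv_def)
qed

lemma join_taiga_eq:
  "join_taiga = generated_congruence (R_sylv \<union> R_sylv_sharp \<union> R_rSt \<union> R_lSt)"
    (is "_ = generated_congruence ?R")
proof
  have "R_sylv \<subseteq> words \<times> words" "R_sylv_sharp \<subseteq> words \<times> words"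
    "R_rSt \<subseteq> words \<times> words" "R_lSt \<subseteq> words \<times> words"
    by (auto simp: R_sylv_def R_sylv_sharp_def R_rSt_def R_lSt_def words_def)
  then have cong: "is_congruence (generated_congruence ?R)"
    by (intro is_congruence_generated_congruence Un_least)
  have "right_taiga \<subseteq> generated_congruence ?R" "left_taiga \<subseteq> generated_congruence ?R"
    unfolding right_taiga_def left_taiga_def
    by (rule generated_congruence_least[OF cong],
        rule subset_trans[OF _ generated_congruence_superset], simp add: le_supI1 le_supI2)+
  then show "join_taiga \<subseteq> generated_congruence ?R"
    unfolding join_taiga_def by (intro generated_congruence_least[OF cong] Un_least)
next
  have "R_sylv \<union> R_rSt \<subseteq> right_taiga" "R_sylv_sharp \<union> R_lSt \<subseteq> left_taiga"
    unfolding right_taiga_def left_taiga_def by (rule generated_congruence_superset)+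
  then have "?R \<subseteq> right_taiga \<union> left_taiga"
    by blast
  then have "{r. is_congruence r \<and> right_taiga \<union> left_taiga \<subseteq> r} \<subseteq> {r. is_congruence r \<and> ?R \<subseteq> r}"
    by blast
  then show "generated_congruence ?R \<subseteq> join_taiga"
    unfolding join_taiga_def generated_congruence_def by (rule Inter_anti_mono)
qed

end

theory Submission
  imports Defs "HOL-Combinatorics.Multiset_Permutations" "HOL-Library.Disjoint_Sets"
begin

text \<open>Two adjacent letters of a word may be interchanged by \<open>\<equiv>\<^sub>j\<^sub>T\<^sub>g\<close> unless both are simple and
  they are neighbours in the support. So the class of \<open>w\<close> is a trace (a class of a partial
  commutation), and it consists of the rearrangements of \<open>w\<close> that have the same projection as \<open>w\<close> on
  each pair of neighbouring simple letters. Each such pair lies in one interval \<open>A\<^sub>j\<close>, and the same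
  description applies to the hypoplactic class of the word \<open>w[A\<^sub>j]\<close>, so the class of \<open>w\<close> consists of
  the rearrangements \<open>v\<close> with \<open>v[A\<^sub>j]\<close> hypoplactically congruent to \<open>w[A\<^sub>j]\<close> for all \<open>j\<close>. Since
  permuting the letters of \<open>A\<^sub>j\<close> acts on the rearrangements of \<open>w\<close>, each of the \<open>|A\<^sub>j|!\<close> possible
  values of \<open>v[A\<^sub>j]\<close> is equally frequent, independently for different \<open>j\<close>.\<close>

section \<open>Traces\<close>

text \<open>The trace of \<open>w\<close> in the partially commutative monoid whose dependent
  letters are those related by \<open>D\<close> in either order, described through the projection
  theorem for traces.\<close>

definition trace_class :: "('a \<times> 'a) set \<Rightarrow> 'a list \<Rightarrow> 'a list set" where
  "trace_class D w = {v. mset v = mset w \<and>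
     (\<forall>(x, y) \<in> D. filter (\<lambda>z. z \<in> {x, y}) v = filter (\<lambda>z. z \<in> {x, y}) w)}"

text \<open>\<open>x\<close> is carried rightwards past \<open>p\<close>, one swap at a time. Swaps
  are provided only for whole words of content \<open>M\<close>, since which letters may be
  exchanged will depend on the content.\<close>

lemma trace_class_move_to_front:
  assumes r: "refl_on X r" "trans r"
    and swap: "\<And>p q x y. x \<noteq> y \<Longrightarrow> (x, y) \<notin> D \<Longrightarrow> (y, x) \<notin> D \<Longrightarrow> mset (p @ x # y # q) = M \<Longrightarrow>
      (p @ x # y # q, p @ y # x # q) \<in> r"
    and X: "\<And>u. mset u = M \<Longrightarrow> u \<in> X"
    and "mset (s @ x # p @ q) = M" "\<forall>y\<in>set p. y \<noteq> x \<and> (x, y) \<notin> D \<and> (y, x) \<notin> D"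
  shows "(s @ x # p @ q, s @ p @ x # q) \<in> r"
  using assms(5,6)
proof (induction p arbitrary: s)
  case Nil
  then show ?case using r(1) X by (auto simp: refl_on_def)
next
  case (Cons y p)
  have "(s @ x # y # (p @ q), s @ y # x # (p @ q)) \<in> r"
    using Cons.prems by (intro swap) auto
  moreover have "((s @ [y]) @ x # p @ q, (s @ [y]) @ p @ x # q) \<in> r"
    using Cons.prems by (intro Cons.IH) (auto simp: add_mset_commute)
  ultimately show ?case using r(2) by (auto elim: transE)
qed

text \<open>Induction on \<open>u\<close>: its first letter \<open>x\<close> commutes with all that
  precedes the first \<open>x\<close> in \<open>v\<close>, so the rest is matched behind
  \<open>x\<close>, and \<open>x\<close> is then carried to its place. The prefix \<open>s\<close>
  keeps every intermediate word at content \<open>M\<close>.\<close>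

lemma trace_class_connected:
  assumes r: "refl_on X r" "trans r"
    and swap: "\<And>p q x y. x \<noteq> y \<Longrightarrow> (x, y) \<notin> D \<Longrightarrow> (y, x) \<notin> D \<Longrightarrow> mset (p @ x # y # q) = M \<Longrightarrow>
      (p @ x # y # q, p @ y # x # q) \<in> r"
    and X: "\<And>u. mset u = M \<Longrightarrow> u \<in> X"
    and "mset (s @ u) = M" "v \<in> trace_class D u"
  shows "(s @ u, s @ v) \<in> r"
  using assms(5,6)
proof (induction u arbitrary: s v)
  case Nil
  then show ?case using r(1) X by (auto simp: refl_on_def trace_class_def)
next
  case (Cons x u)
  have v: "mset v = mset (x # u)"
    and proj: "\<And>a b. (a, b) \<in> D \<Longrightarrow>
      filter (\<lambda>z. z \<in> {a, b}) v = filter (\<lambda>z. z \<in> {a, b}) (x # u)"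
    using Cons.prems(2) unfolding trace_class_def by blast+
  have "x \<in> set v" using v by (metis list.set_intros(1) mset_eq_setD)
  then obtain p q where pq: "v = p @ x # q" "x \<notin> set p" by (meson split_list_first)
  \<comment> \<open>If a projection of \<open>v\<close> starts with \<open>x\<close> and keeps a
    letter of \<open>p\<close>, then that first \<open>x\<close> comes from \<open>p\<close>, which
    is excluded. So \<open>p\<close> has no letter dependent on \<open>x\<close>.\<close>
  have hd: "x \<in> set p" if "filter P (p @ q') = x # zs" "y \<in> set p" "P y" for P q' zs y
  proof -
    have "y \<in> set (filter P p)" using that by simp
    then obtain z zs' where "filter P p = z # zs'" by (cases "filter P p") auto
    then have "x \<in> set (filter P p)" using that(1) by simp
    then show ?thesis by simp
  qed
  have indep: "(x, y) \<notin> D \<and> (y, x) \<notin> D" if y: "y \<in> set p" for y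
    using proj[of x y] proj[of y x] hd[OF _ y, of "\<lambda>z. z \<in> {x, y}" "x # q"]
      hd[OF _ y, of "\<lambda>z. z \<in> {y, x}" "x # q"] pq
    by (metis filter.simps(2) insertCI)
  \<comment> \<open>Nothing of \<open>p\<close> survives in a projection to a dependent pair
    containing \<open>x\<close>, so deleting \<open>x\<close> removes the first letter on both
    sides.\<close>
  have "p @ q \<in> trace_class D u"
    unfolding trace_class_def
  proof (intro CollectI conjI, goal_cases)
    case 1
    show ?case using v by (simp add: pq)
  next
    case 2
    have "filter (\<lambda>z. z = a \<or> z = b) (p @ q) = filter (\<lambda>z. z = a \<or> z = b) u"
      if ab: "(a, b) \<in> D" for a b
    proof (cases "x = a \<or> x = b")
      case True
      have "filter (\<lambda>z. z = a \<or> z = b) p = []"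
        using indep ab True pq(2) by (auto simp: filter_empty_conv)
      then show ?thesis using proj[OF ab] True by (auto simp: pq(1))
    next
      case False
      then show ?thesis using proj[OF ab] by (auto simp: pq(1))
    qed
    then show ?case by auto
  qed
  then have "((s @ [x]) @ u, (s @ [x]) @ p @ q) \<in> r"
    using Cons.prems(1) by (intro Cons.IH) auto
  moreover have "(s @ x # p @ q, s @ p @ x # q) \<in> r"
    using Cons.prems(1) v pq(2) indep
    by (intro trace_class_move_to_front[OF r swap X]) (auto simp: pq(1))
  ultimately show ?case using r(2) by (auto simp: pq(1) elim: transE)
qed

section \<open>The congruence classes as traces\<close>

text \<open>The dependency relation of the trace, each pair stored once with the smaller letter
  first. It depends only on the content, so it is constant along a chain of swaps.\<close>

definition simple_covers :: "nat list \<Rightarrow> (nat \<times> nat) set" where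
  "simple_covers w = {(x, y). x \<in> simple_letters w \<and> y \<in> simple_letters w \<and> x < y \<and>
     (\<forall>z\<in>set w. \<not> (x < z \<and> z < y))}"

lemma simple_letters_cong: "mset u = mset v \<Longrightarrow> simple_letters u = simple_letters v"
  unfolding simple_letters_def by (metis count_mset)

lemma simple_covers_cong: "mset u = mset v \<Longrightarrow> simple_covers u = simple_covers v"
  unfolding simple_covers_def by (metis simple_letters_cong mset_eq_setD)

lemma simple_letters_subset: "simple_letters w \<subseteq> set w"
  unfolding simple_letters_def by (auto intro: ccontr dest: count_notin)

text \<open>With one letter absent, the projection is a power of the other letter, fixed by the
  content.\<close>

lemma filter_pair_eq_if_missing:
  assumes "mset u = mset v" "x \<notin> set u"
  shows "filter (\<lambda>z. z = x \<or> z = y) u = filter (\<lambda>z. z = x \<or> z = y) v"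
proof -
  have *: "filter (\<lambda>z. z = x \<or> z = y) t = replicate (count (mset t) y) y"
    if "x \<notin> set t" for t
    using that by (induction t) auto
  have "x \<notin> set v" using assms by (metis mset_eq_setD)
  then show ?thesis using assms by (simp add: *)
qed

section \<open>An invariant of the join-taiga congruence\<close>

definition trace_rel :: "(nat list \<times> nat list) set" where
  "trace_rel = {(u, v). u \<in> words \<and> v \<in> words \<and> v \<in> trace_class (simple_covers u) u}"

lemma trace_rel_iff:
  "(u, v) \<in> trace_rel \<longleftrightarrow> u \<in> words \<and> v \<in> words \<and> mset v = mset u \<and>
    (\<forall>x y. (x, y) \<in> simple_covers u \<longrightarrow>
      filter (\<lambda>z. z = x \<or> z = y) v = filter (\<lambda>z. z = x \<or> z = y) u)"
  by (auto simp: trace_rel_def trace_class_def)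

text \<open>Support and multiplicities grow with the context, so a cover of the longer word with
  both letters in \<open>u\<close> is already a cover of \<open>u\<close>. If one letter is missing
  from \<open>u\<close>, then \<open>u\<close> and \<open>v\<close> project to the same power of the
  other.\<close>

lemma trace_rel_context:
  assumes uv: "(u, v) \<in> trace_rel" and pq: "p \<in> words" "q \<in> words"
  shows "(p @ u @ q, p @ v @ q) \<in> trace_rel"
proof -
  have m: "mset v = mset u"
    and proj: "\<And>x y. (x, y) \<in> simple_covers u \<Longrightarrow>
      filter (\<lambda>z. z = x \<or> z = y) v = filter (\<lambda>z. z = x \<or> z = y) u"
    using uv by (auto simp: trace_rel_def trace_class_def)
  have "filter (\<lambda>z. z = x \<or> z = y) v = filter (\<lambda>z. z = x \<or> z = y) u"
    if c: "(x, y) \<in> simple_covers (p @ u @ q)" for x y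
  proof (cases "x \<in> set u \<and> y \<in> set u")
    case True
    then have "count_list u x > 0" "count_list u y > 0"
      by (metis count_list_0_iff gr0I)+
    with c have "(x, y) \<in> simple_covers u"
      by (auto simp: simple_covers_def simple_letters_def)
    then show ?thesis by (rule proj)
  next
    case False
    with filter_pair_eq_if_missing[of u v x y] filter_pair_eq_if_missing[of u v y x] m
    show ?thesis by (auto simp: disj_commute)
  qed
  then show ?thesis
    using uv pq m by (auto simp: trace_rel_def trace_class_def words_def)
qed

lemma is_congruence_trace_rel: "is_congruence trace_rel"
proof -
  have "refl_on words trace_rel"
    by (auto simp: refl_on_def trace_rel_def trace_class_def)
  moreover have "sym trace_rel"
  proof (rule symI)
    fix u v assume uv: "(u, v) \<in> trace_rel"
    then have "simple_covers u = simple_covers v"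
      by (intro simple_covers_cong) (simp add: trace_rel_iff)
    with uv show "(v, u) \<in> trace_rel"
      by (simp add: trace_rel_iff)
  qed
  moreover have "trans trace_rel"
  proof (rule transI)
    fix u v t assume uv: "(u, v) \<in> trace_rel" and vt: "(v, t) \<in> trace_rel"
    then have "simple_covers u = simple_covers v"
      by (intro simple_covers_cong) (simp add: trace_rel_iff)
    with uv vt show "(u, t) \<in> trace_rel"
      by (simp add: trace_rel_iff)
  qed
  moreover have "trace_rel \<subseteq> words \<times> words"
    by (auto simp: trace_rel_def)
  ultimately show ?thesis
    unfolding is_congruence_def equiv_def using trace_rel_context by blast
qed

text \<open>An adjacent swap can change only the projection to the swapped pair.\<close>

lemma swap_in_trace_rel:
  assumes "p @ x # y # q \<in> words"
    "(x, y) \<notin> simple_covers (p @ x # y # q)" "(y, x) \<notin> simple_covers (p @ x # y # q)"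
  shows "(p @ x # y # q, p @ y # x # q) \<in> trace_rel"
  using assms by (auto simp: trace_rel_def trace_class_def words_def)

text \<open>By minimality only the generators matter. Each swaps two adjacent letters that form no
  cover: \<open>b\<close> lies strictly between them or is a further copy of one of them.\<close>

lemma join_taiga_subset_trace_rel: "join_taiga \<subseteq> trace_rel"
proof -
  have "R_sylv \<subseteq> trace_rel"
  proof (clarsimp simp: R_sylv_def)
    fix a b c u
    assume "Suc 0 \<le> a" "a \<le> b" "b < c" "u \<in> words"
    then show "(c # a # u @ [b], a # c # u @ [b]) \<in> trace_rel"
      using swap_in_trace_rel[of "[]" c a "u @ [b]"]
      by (auto simp: words_def simple_covers_def simple_letters_def)
  qed
  moreover have "R_sylv_sharp \<subseteq> trace_rel"
  proof (clarsimp simp: R_sylv_sharp_def)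
    fix a b c u
    assume "Suc 0 \<le> a" "a < b" "b \<le> c" "u \<in> words"
    then show "(b # u @ [a, c], b # u @ [c, a]) \<in> trace_rel"
      using swap_in_trace_rel[of "b # u" a c "[]"]
      by (auto simp: words_def simple_covers_def simple_letters_def)
  qed
  moreover have "R_rSt \<subseteq> trace_rel"
  proof (clarsimp simp: R_rSt_def)
    fix a b u
    assume "Suc 0 \<le> a" "Suc 0 \<le> b" "u \<in> words"
    then show "(b # a # u @ [b], a # b # u @ [b]) \<in> trace_rel"
      using swap_in_trace_rel[of "[]" b a "u @ [b]"]
      by (auto simp: words_def simple_covers_def simple_letters_def split: if_splits)
  qed
  moreover have "R_lSt \<subseteq> trace_rel"
  proof (clarsimp simp: R_lSt_def)
    fix a b u
    assume "Suc 0 \<le> a" "Suc 0 \<le> b" "u \<in> words"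
    then show "(b # u @ [a, b], b # u @ [b, a]) \<in> trace_rel"
      using swap_in_trace_rel[of "b # u" a b "[]"]
      by (auto simp: words_def simple_covers_def simple_letters_def split: if_splits)
  qed
  ultimately show ?thesis
    unfolding join_taiga_eq
    by (intro generated_congruence_least is_congruence_trace_rel Un_least)
qed

section \<open>Realising the permitted swaps by the generators\<close>

lemma generators_subset_hypoplactic: "R_sylv \<union> R_sylv_sharp \<subseteq> hypoplactic"
  unfolding hypoplactic_def by (rule generated_congruence_superset)

lemma generators_subset_join_taiga: "R_sylv \<union> R_sylv_sharp \<union> R_rSt \<union> R_lSt \<subseteq> join_taiga"
  unfolding join_taiga_eq by (rule generated_congruence_superset)

lemma is_congruence_hypoplactic: "is_congruence hypoplactic"
  unfolding hypoplactic_def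
  by (rule is_congruence_generated_congruence)
    (auto simp: R_sylv_def R_sylv_sharp_def words_def)

lemma is_congruence_join_taiga: "is_congruence join_taiga"
  unfolding join_taiga_eq
  by (rule is_congruence_generated_congruence)
    (auto simp: R_sylv_def R_sylv_sharp_def R_rSt_def R_lSt_def words_def)

lemma hypoplactic_subset_join_taiga: "hypoplactic \<subseteq> join_taiga"
proof -
  have "R_sylv \<union> R_sylv_sharp \<subseteq> join_taiga"
    using generators_subset_join_taiga by blast
  then show ?thesis
    unfolding hypoplactic_def
    by (rule generated_congruence_least[OF is_congruence_join_taiga])
qed

lemma congruence_context:
  assumes "is_congruence r" "(u, v) \<in> r" "p \<in> words" "q \<in> words"
  shows "(p @ u @ q, p @ v @ q) \<in> r" "(p @ v @ q, p @ u @ q) \<in> r"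
proof -
  show "(p @ u @ q, p @ v @ q) \<in> r"
    using assms unfolding is_congruence_def by blast
  moreover have "sym r" using assms(1) by (simp add: is_congruence_def equiv_def)
  ultimately show "(p @ v @ q, p @ u @ q) \<in> r" by (auto dest: symD)
qed

text \<open>A \<open>z\<close> to the left of the pair yields an instance of
  \<open>R_sylv_sharp\<close>, one to the right an instance of \<open>R_sylv\<close>.\<close>

lemma hypoplactic_swap_less:
  assumes w: "p @ x # y # q \<in> words" and z: "x < z" "z < y" "z \<in> set (p @ q)"
  shows "(p @ x # y # q, p @ y # x # q) \<in> hypoplactic \<and>
    (p @ y # x # q, p @ x # y # q) \<in> hypoplactic"
proof (cases "z \<in> set p")
  case True
  then obtain p1 u where p: "p = p1 @ z # u" by (meson split_list)
  have "([z] @ u @ [x, y], [z] @ u @ [y, x]) \<in> R_sylv_sharp"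
    using w z p by (fastforce simp: R_sylv_sharp_def words_def)
  then have "([z] @ u @ [x, y], [z] @ u @ [y, x]) \<in> hypoplactic"
    using generators_subset_hypoplactic by blast
  from congruence_context[OF is_congruence_hypoplactic this, of p1 q]
  show ?thesis using w by (simp add: p words_def)
next
  case False
  then obtain u q1 where q: "q = u @ z # q1" using z by (auto dest: split_list)
  have "([y, x] @ u @ [z], [x, y] @ u @ [z]) \<in> R_sylv"
    using w z q by (fastforce simp: R_sylv_def words_def)
  then have "([y, x] @ u @ [z], [x, y] @ u @ [z]) \<in> hypoplactic"
    using generators_subset_hypoplactic by blast
  from congruence_context[OF is_congruence_hypoplactic this, of p q1]
  show ?thesis using w by (simp add: q words_def)
qed

text \<open>Since both letters are simple, failing to be a cover means that a letter of the support
  lies strictly between them; it differs from both, so it occurs outside the adjacent pair.\<close>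

lemma hypoplactic_swap:
  assumes "p @ x # y # q \<in> words" "x \<noteq> y"
    "x \<in> simple_letters (p @ x # y # q)" "y \<in> simple_letters (p @ x # y # q)"
    "(x, y) \<notin> simple_covers (p @ x # y # q)" "(y, x) \<notin> simple_covers (p @ x # y # q)"
  shows "(p @ x # y # q, p @ y # x # q) \<in> hypoplactic"
proof -
  consider z where "x < z" "z < y" "z \<in> set (p @ q)" | z where "y < z" "z < x" "z \<in> set (p @ q)"
  proof (cases "x < y")
    case True
    then show ?thesis using assms(3-5) that(1) by (auto simp: simple_covers_def)
  next
    case False
    then show ?thesis using assms(2-4,6) that(2) by (auto simp: simple_covers_def)
  qed
  then show ?thesis
  proof cases
    case 1
    then show ?thesis using hypoplactic_swap_less assms(1) by blast
  next
    case 2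
    moreover have "p @ y # x # q \<in> words" using assms(1) by (auto simp: words_def)
    ultimately show ?thesis using hypoplactic_swap_less by blast
  qed
qed

text \<open>A further \<open>x\<close> to the left yields an instance of \<open>R_lSt\<close>, one
  to the right an instance of \<open>R_rSt\<close>. Both orientations are recorded so that the roles
  of \<open>x\<close> and \<open>y\<close> can be exchanged.\<close>

lemma join_taiga_swap_repeated:
  assumes w: "p @ x # y # q \<in> words" and x: "x \<in> set (p @ q)"
  shows "(p @ x # y # q, p @ y # x # q) \<in> join_taiga \<and>
    (p @ y # x # q, p @ x # y # q) \<in> join_taiga"
proof (cases "x \<in> set p")
  case True
  then obtain p1 u where p: "p = p1 @ x # u" by (meson split_list)
  have "([x] @ u @ [y, x], [x] @ u @ [x, y]) \<in> R_lSt"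
    using w p by (fastforce simp: R_lSt_def words_def)
  then have "([x] @ u @ [y, x], [x] @ u @ [x, y]) \<in> join_taiga"
    using generators_subset_join_taiga by blast
  from congruence_context[OF is_congruence_join_taiga this, of p1 q]
  show ?thesis using w by (simp add: p words_def)
next
  case False
  then obtain u q1 where q: "q = u @ x # q1" using x by (auto dest: split_list)
  have "([x, y] @ u @ [x], [y, x] @ u @ [x]) \<in> R_rSt"
    using w q by (fastforce simp: R_rSt_def words_def)
  then have "([x, y] @ u @ [x], [y, x] @ u @ [x]) \<in> join_taiga"
    using generators_subset_join_taiga by blast
  from congruence_context[OF is_congruence_join_taiga this, of p q1]
  show ?thesis using w by (simp add: q words_def)
qed

lemma join_taiga_swap:
  assumes w: "p @ x # y # q \<in> words" and "x \<noteq> y"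
    "(x, y) \<notin> simple_covers (p @ x # y # q)" "(y, x) \<notin> simple_covers (p @ x # y # q)"
  shows "(p @ x # y # q, p @ y # x # q) \<in> join_taiga"
proof -
  have w': "p @ y # x # q \<in> words" using w by (auto simp: words_def)
  \<comment> \<open>As \<open>x\<close> and \<open>y\<close> differ, a second occurrence of either
    lies outside the pair.\<close>
  have rep: "z \<in> set (p @ q)"
    if "z \<notin> simple_letters (p @ x # y # q)" "z \<in> {x, y}" for z
    using that \<open>x \<noteq> y\<close> by (auto simp: simple_letters_def intro: ccontr)
  show ?thesis
    using hypoplactic_swap[OF assms(1,2) _ _ assms(3,4)] hypoplactic_subset_join_taiga
      join_taiga_swap_repeated[OF w rep] join_taiga_swap_repeated[OF w' rep]
    by blast
qed

lemma mset_words: "mset u = mset w \<Longrightarrow> w \<in> words \<Longrightarrow> u \<in> words"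
  by (metis words_def in_lists_conv_set mset_eq_setD)

text \<open>All words on a chain of swaps have the content of \<open>w\<close>, hence its covers, so
  the swap condition can be read off the current word.\<close>

lemma trace_class_subset_class:
  assumes r: "is_congruence r" and w: "w \<in> words"
    and swap: "\<And>p q x y. mset (p @ x # y # q) = mset w \<Longrightarrow> p @ x # y # q \<in> words \<Longrightarrow> x \<noteq> y \<Longrightarrow>
      (x, y) \<notin> simple_covers (p @ x # y # q) \<Longrightarrow> (y, x) \<notin> simple_covers (p @ x # y # q) \<Longrightarrow>
      (p @ x # y # q, p @ y # x # q) \<in> r"
  shows "trace_class (simple_covers w) w \<subseteq> r `` {w}"
proof
  fix v assume v: "v \<in> trace_class (simple_covers w) w"
  have "refl_on words r" "trans r" using r by (auto simp: is_congruence_def equiv_def)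
  moreover have "(p @ x # y # q, p @ y # x # q) \<in> r"
    if "x \<noteq> y" "(x, y) \<notin> simple_covers w" "(y, x) \<notin> simple_covers w"
      and m: "mset (p @ x # y # q) = mset w" for p q x y
    using swap[OF m mset_words[OF m w]] that(1-3) simple_covers_cong[OF m] by simp
  ultimately have "([] @ w, [] @ v) \<in> r"
    using trace_class_connected[of words r "simple_covers w" "mset w" "[]" w v] v mset_words[OF _ w]
    by simp
  then show "v \<in> r `` {w}" by simp
qed

lemma join_taiga_class:
  assumes "w \<in> words"
  shows "join_taiga `` {w} = trace_class (simple_covers w) w"
proof
  show "join_taiga `` {w} \<subseteq> trace_class (simple_covers w) w"
    using join_taiga_subset_trace_rel by (auto simp: trace_rel_def)
  show "trace_class (simple_covers w) w \<subseteq> join_taiga `` {w}"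
    by (intro trace_class_subset_class is_congruence_join_taiga assms join_taiga_swap)
qed

text \<open>Without repetitions all letters are simple, so every permitted swap is already
  hypoplactic; the other inclusion is inherited from \<open>join_taiga\<close>.\<close>

lemma hypoplactic_class_distinct:
  assumes w: "w \<in> words" and "distinct w"
  shows "hypoplactic `` {w} = trace_class (simple_covers w) w"
proof
  show "hypoplactic `` {w} \<subseteq> trace_class (simple_covers w) w"
    using join_taiga_class[OF w] hypoplactic_subset_join_taiga by blast
  have "z \<in> simple_letters u" if "mset u = mset w" "z \<in> set u" for u z
  proof -
    have "distinct u" using that \<open>distinct w\<close> by (metis mset_eq_imp_distinct_iff)
    then show ?thesis
      using that(2) by (simp add: simple_letters_def distinct_count_atmost_1 flip: count_mset)
  qed
  then show "trace_class (simple_covers w) w \<subseteq> hypoplactic `` {w}"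
    by (intro trace_class_subset_class is_congruence_hypoplactic w hypoplactic_swap) auto
qed

section \<open>Maximal intervals of simple letters\<close>

text \<open>Among the simple intervals containing \<open>I\<close>, one of greatest cardinality
  admits no one-letter extension.\<close>

lemma ex_max_simple_interval:
  assumes "is_interval_of (set w) I" "I \<subseteq> simple_letters w"
  shows "\<exists>A\<in>max_simple_intervals w. I \<subseteq> A"
proof -
  define P where "P = (\<lambda>J. is_interval_of (set w) J \<and> J \<subseteq> simple_letters w \<and> I \<subseteq> J)"
  have sub: "J \<subseteq> set w" if "P J" for J
    using that by (auto simp: P_def is_interval_of_def)
  have "P I" using assms by (simp add: P_def)
  moreover have "\<forall>J. P J \<longrightarrow> card J \<le> card (set w)"
    using sub by (simp add: card_mono)
  ultimately obtain A where A: "P A" and max: "\<And>J. P J \<Longrightarrow> card J \<le> card A"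
    using ex_has_greatest_nat[of P I card "Suc (card (set w))"]
    by (auto simp: less_Suc_eq_le)
  have "\<not> is_interval_of (set w) (A \<union> {a})" if "a \<in> simple_letters w" "a \<notin> A" for a
  proof
    assume "is_interval_of (set w) (A \<union> {a})"
    then have "P (A \<union> {a})" using A that(1) by (auto simp: P_def)
    moreover have "finite A" using sub[OF A] by (auto intro: finite_subset)
    ultimately show False using max[of "A \<union> {a}"] that(2) by simp
  qed
  then show ?thesis
    using A by (auto simp: max_simple_intervals_def P_def)
qed

lemma max_simple_intervals_simple:
  assumes "A \<in> max_simple_intervals w"
  shows "A \<subseteq> set w" "A \<subseteq> simple_letters w"
  using assms by (auto simp: max_simple_intervals_def is_interval_of_def)

lemma max_simple_intervals_convex:
  assumes "A \<in> max_simple_intervals w" "x \<in> A" "z \<in> A" "y \<in> set w" "x \<le> y" "y \<le> z"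
  shows "y \<in> A"
  using assms unfolding max_simple_intervals_def is_interval_of_def by blast

text \<open>Maximality forbids adding single letters, so rather than joining \<open>A\<close> and
  \<open>B\<close>, the letter of \<open>B - A\<close> nearest to \<open>c\<close> on one side is
  adjoined to \<open>A\<close>, giving a forbidden interval.\<close>

lemma max_simple_intervals_subset:
  assumes A: "A \<in> max_simple_intervals w" and B: "B \<in> max_simple_intervals w"
    and c: "c \<in> A" "c \<in> B"
  shows "B \<subseteq> A"
proof (rule ccontr)
  note intA = max_simple_intervals_convex[OF A] and intB = max_simple_intervals_convex[OF B]
    and sub = max_simple_intervals_simple[OF A] max_simple_intervals_simple[OF B]
  have maxA: "\<not> is_interval_of (set w) (A \<union> {a})" if "a \<in> simple_letters w" "a \<notin> A" for a
    using A that unfolding max_simple_intervals_def by blast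
  assume "\<not> B \<subseteq> A"
  then obtain b where b: "b \<in> B - A" by blast
  have fin: "finite (B - A)" using sub by (auto intro: finite_subset)
  have "\<exists>a\<in>B - A. is_interval_of (set w) (A \<union> {a})"
  proof (cases "c < b")
    case True
    let ?U = "{a \<in> B - A. c < a}"
    have U: "finite ?U" "?U \<noteq> {}" using fin b True by (auto intro: finite_subset[OF _ fin])
    define a where "a = Min ?U"
    have a: "a \<in> B - A" "c < a" using Min_in[OF U] by (auto simp: a_def)
    have least: "a \<le> y" if "y \<in> B - A" "c < y" for y
      using Min_le[OF U(1)] that by (simp add: a_def)
    \<comment> \<open>Letters of the support strictly between \<open>c\<close> and \<open>a\<close>
      are in \<open>B\<close> by convexity, hence in \<open>A\<close> by the choice of
      \<open>a\<close>: no gap separates \<open>a\<close> from \<open>A\<close>.\<close>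
    have below: "y \<in> A" if "y \<in> set w" "x \<in> A" "x \<le> y" "y < a" for x y
    proof (cases "y \<le> c")
      case False
      then have "y \<in> B" using intB[of c a y] a c that by auto
      then show ?thesis using least[of y] that False by force
    qed (use intA c that in blast)
    have above: "\<not> a \<le> z" if "z \<in> A" for z
      using intA[of c z a] a c sub that by auto
    have "y \<in> A \<union> {a}"
      if "x \<in> A \<union> {a}" "z \<in> A \<union> {a}" "y \<in> set w" "x \<le> y" "y \<le> z" for x y z
      using below[of y x] above[of z] intA[of x z y] that
      by (cases "y = a") auto
    then have "is_interval_of (set w) (A \<union> {a})"
      using a(1) sub(1,3) unfolding is_interval_of_def by blast
    with a show ?thesis by blast
  next
    case False
    \<comment> \<open>Mirror image: the letter of \<open>B - A\<close> nearest to \<open>c\<close>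
      from below.\<close>
    let ?U = "{a \<in> B - A. a < c}"
    have "b < c" using False b c by (metis DiffE linorder_neqE_nat)
    then have U: "finite ?U" "?U \<noteq> {}" using fin b by (auto intro: finite_subset[OF _ fin])
    define a where "a = Max ?U"
    have a: "a \<in> B - A" "a < c" using Max_in[OF U] by (auto simp: a_def)
    have greatest: "y \<le> a" if "y \<in> B - A" "y < c" for y
      using Max_ge[OF U(1)] that by (simp add: a_def)
    have above: "y \<in> A" if "y \<in> set w" "z \<in> A" "y \<le> z" "a < y" for y z
    proof (cases "c \<le> y")
      case False
      then have "y \<in> B" using intB[of a c y] a c that by auto
      then show ?thesis using greatest[of y] that False by force
    qed (use intA c that in blast)
    have below: "\<not> z \<le> a" if "z \<in> A" for z
      using intA[of z c a] a c sub that by auto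
    have "y \<in> A \<union> {a}"
      if "x \<in> A \<union> {a}" "z \<in> A \<union> {a}" "y \<in> set w" "x \<le> y" "y \<le> z" for x y z
      using above[of y z] below[of x] intA[of x z y] that
      by (cases "y = a") auto
    then have "is_interval_of (set w) (A \<union> {a})"
      using a(1) sub(1,3) unfolding is_interval_of_def by blast
    with a show ?thesis by blast
  qed
  then show False using maxA sub by blast
qed

lemma disjoint_max_simple_intervals: "disjoint (max_simple_intervals w)"
  unfolding disjoint_def using max_simple_intervals_subset by blast

lemma finite_max_simple_intervals: "finite (max_simple_intervals w)"
  by (rule finite_subset[of _ "Pow (set w)"])
    (auto simp: max_simple_intervals_def is_interval_of_def)

text \<open>By convexity, deleting the letters outside \<open>A\<close> removes none that lies
  between two members of \<open>A\<close>.\<close>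

lemma simple_covers_restrict_word:
  assumes A: "A \<in> max_simple_intervals w"
  shows "simple_covers (restrict_word w A) = simple_covers w \<inter> A \<times> A"
proof -
  have "simple_letters (restrict_word w A) = A"
  proof -
    have "count_list (filter (\<lambda>x. x \<in> A) u) x = (if x \<in> A then count_list u x else 0)" for u x
      by (induction u) auto
    then show ?thesis
      using max_simple_intervals_simple[OF A]
      by (auto simp: simple_letters_def restrict_word_def split: if_splits)
  qed
  moreover have "set (restrict_word w A) = set w \<inter> A"
    by (auto simp: restrict_word_def)
  moreover have "(\<forall>z\<in>set w \<inter> A. \<not> (x < z \<and> z < y)) \<longleftrightarrow> (\<forall>z\<in>set w. \<not> (x < z \<and> z < y))"
    if "x \<in> A" "y \<in> A" for x y
    using max_simple_intervals_convex[OF A that] by (meson IntD1 IntI less_imp_le)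
  ultimately show ?thesis
    using max_simple_intervals_simple(2)[OF A] by (auto simp: simple_covers_def simp del: Int_iff)
qed

text \<open>A cover is itself a two-element interval of simple letters, so it extends to a maximal
  one.\<close>

lemma simple_covers_in_max_simple_interval:
  assumes "(x, y) \<in> simple_covers w"
  shows "\<exists>A\<in>max_simple_intervals w. x \<in> A \<and> y \<in> A"
proof -
  have "is_interval_of (set w) {x, y}" "{x, y} \<subseteq> simple_letters w"
    using assms simple_letters_subset[of w]
    by (auto simp: is_interval_of_def simple_covers_def le_less)
  then show ?thesis using ex_max_simple_interval by fastforce
qed

text \<open>Every dependent pair lies in one block, and its projection factors through the
  projection to that block, so the trace condition splits blockwise.\<close>

lemma trace_class_simple_covers_decompose:
  "trace_class (simple_covers w) w =
    {v \<in> permutations_of_multiset (mset w). \<forall>A\<in>max_simple_intervals w.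
      filter (\<lambda>x. x \<in> A) v \<in>
        trace_class (simple_covers (restrict_word w A)) (restrict_word w A)}"
    (is "?L = ?R")
proof -
  have ff: "filter (\<lambda>z. z = x \<or> z = y) (filter (\<lambda>x. x \<in> A) v) = filter (\<lambda>z. z = x \<or> z = y) v"
    if "x \<in> A" "y \<in> A" for x y :: nat and A v
    using that by (auto intro: filter_cong)
  have "v \<in> ?R" if "v \<in> ?L" for v
  proof -
    have "filter (\<lambda>x. x \<in> A) v \<in> trace_class (simple_covers w \<inter> A \<times> A) (restrict_word w A)" for A
      using that
      by (auto simp: trace_class_def restrict_word_def ff simp del: filter_filter)
    then show ?thesis
      using that
      by (simp add: simple_covers_restrict_word trace_class_def permutations_of_multiset_def)
  qed
  moreover have "v \<in> ?L" if v: "v \<in> ?R" for v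
  proof -
    have "filter (\<lambda>z. z = x \<or> z = y) v = filter (\<lambda>z. z = x \<or> z = y) w"
      if xy: "(x, y) \<in> simple_covers w" for x y
    proof -
      obtain A where A: "A \<in> max_simple_intervals w" "x \<in> A" "y \<in> A"
        using simple_covers_in_max_simple_interval[OF xy] by blast
      then have "filter (\<lambda>x. x \<in> A) v \<in> trace_class (simple_covers w \<inter> A \<times> A) (restrict_word w A)"
        using v simple_covers_restrict_word by auto
      then have "filter (\<lambda>z. z \<in> {x, y}) (filter (\<lambda>x. x \<in> A) v) =
          filter (\<lambda>z. z \<in> {x, y}) (restrict_word w A)"
        using A xy unfolding trace_class_def by blast
      then show ?thesis
        using ff[OF A(2,3), of v] ff[OF A(2,3), of w]
        by (simp add: restrict_word_def del: filter_filter)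
    qed
    then show ?thesis
      using v by (auto simp: trace_class_def permutations_of_multiset_def)
  qed
  ultimately show ?thesis by blast
qed

section \<open>Counting rearrangements with prescribed projections\<close>

lemma ex_permutes_map_eq:
  assumes "t \<in> permutations_of_set A" "t' \<in> permutations_of_set A"
  shows "\<exists>\<pi>. \<pi> permutes A \<and> map \<pi> t = t'"
proof -
  have t: "distinct t" "set t = A" "distinct t'" "set t' = A"
    using assms by (auto simp: permutations_of_set_def)
  have len: "length t = length t'" using t by (metis distinct_card)
  \<comment> \<open>\<open>g\<close> matches letters at equal positions of \<open>t\<close> and
    \<open>t'\<close>; off \<open>A\<close> it is the identity, as \<open>permutes\<close>
    demands.\<close>
  define g where "g = (\<lambda>x. if x \<in> A then t' ! inv_into {..<length t} ((!) t) x else x)"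
  have b: "bij_betw ((!) t) {..<length t} A" "bij_betw ((!) t') {..<length t} A"
    using t len by (auto intro!: bij_betw_nth)
  have "bij_betw ((!) t' \<circ> inv_into {..<length t} ((!) t)) A A"
    using b by (blast intro: bij_betw_trans bij_betw_inv_into)
  then have "bij_betw g A A" by (rule bij_betw_cong[THEN iffD1, rotated]) (simp add: g_def)
  then have "g permutes A" by (rule bij_imp_permutes) (simp add: g_def)
  moreover have "map g t = t'"
    using t b(1) len by (intro nth_equalityI)
      (auto simp: g_def bij_betw_def)
  ultimately show ?thesis by blast
qed

text \<open>Letters are exchanged only within \<open>A\<close>, where all multiplicities are
  one.\<close>

lemma mset_map_permutes_simple:
  assumes \<pi>: "\<pi> permutes A" and simple: "\<And>x. x \<in> A \<Longrightarrow> count M x = 1"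
  shows "image_mset \<pi> M = M"
proof (rule multiset_eqI)
  fix x
  obtain y where y: "x = \<pi> y" using permutes_surj[OF \<pi>] by (metis surjD)
  have "count (image_mset \<pi> M) x = count M y"
  proof -
    have "{z. z \<in># M \<and> x = \<pi> z} = (if y \<in># M then {y} else {})"
      using permutes_inj[OF \<pi>] y by (auto dest: injD)
    then show ?thesis by (simp add: count_image_mset' not_in_iff)
  qed
  also have "\<dots> = count M x"
    using simple y permutes_in_image[OF \<pi>, of y] permutes_not_in[OF \<pi>, of y] by metis
  finally show "count (image_mset \<pi> M) x = count M x" .
qed

text \<open>The symmetric group of \<open>A\<close> acts on \<open>S\<close> and the projection is
  equivariant, so by transitivity all fibres over arrangements of \<open>A\<close> have the same
  size. A general invariant \<open>S\<close> lets the blocks be treated one after another.\<close>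

lemma card_prescribed_projection:
  assumes fin: "finite S" and S: "S \<subseteq> permutations_of_multiset M"
    and closed: "\<And>v \<pi>. v \<in> S \<Longrightarrow> \<pi> permutes A \<Longrightarrow> map \<pi> v \<in> S"
    and A: "finite A" "\<And>x. x \<in> A \<Longrightarrow> count M x = 1"
    and C: "C \<subseteq> permutations_of_set A"
  shows "card {v \<in> S. filter (\<lambda>x. x \<in> A) v \<in> C} * fact (card A) = card S * card C"
proof -
  let ?f = "filter (\<lambda>x. x \<in> A)"
  let ?F = "\<lambda>t. {v \<in> S. ?f v = t}"
  have range: "?f v \<in> permutations_of_set A" if "v \<in> S" for v
  proof -
    have "mset v = M" using S that by (auto simp: permutations_of_multiset_def)
    then have one: "count (mset v) x = 1" if "x \<in> A" for x using A(2) that by simp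
    then have "A \<subseteq> set v" by (metis count_mset_0_iff subsetI zero_neq_one)
    then show ?thesis
      using one by (auto simp: permutations_of_set_def distinct_count_atmost_1)
  qed
  have le: "card (?F t) \<le> card (?F t')"
    if t: "t \<in> permutations_of_set A" "t' \<in> permutations_of_set A" for t t'
  proof -
    obtain \<pi> where \<pi>: "\<pi> permutes A" "map \<pi> t = t'"
      using ex_permutes_map_eq[OF t] by blast
    have "?f (map \<pi> v) = map \<pi> (?f v)" for v
      using permutes_in_image[OF \<pi>(1)] by (simp add: filter_map o_def)
    then have "map \<pi> ` ?F t \<subseteq> ?F t'" using closed \<pi> by auto
    moreover have "inj_on (map \<pi>) (?F t)"
      using permutes_inj[OF \<pi>(1)] by (meson inj_mapI inj_on_subset subset_UNIV)
    ultimately show ?thesis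
      using fin by (intro card_inj_on_le[of "map \<pi>"]) auto
  qed
  \<comment> \<open>The common fibre size, read off at an arbitrary arrangement of
    \<open>A\<close>.\<close>
  define k where "k = card (?F (SOME t. t \<in> permutations_of_set A))"
  have k: "card (?F t) = k" if "t \<in> permutations_of_set A" for t
  proof -
    have "(SOME t. t \<in> permutations_of_set A) \<in> permutations_of_set A"
      using that by (rule someI)
    then show ?thesis unfolding k_def using that le by (intro le_antisym)
  qed
  have count: "card {v \<in> S. ?f v \<in> T} = card T * k" if T: "T \<subseteq> permutations_of_set A" for T
  proof -
    have "finite T" using T A(1) by (auto intro: finite_subset)
    moreover have "{v \<in> S. ?f v \<in> T} = (\<Union>t\<in>T. ?F t)" by auto
    ultimately have "card {v \<in> S. ?f v \<in> T} = (\<Sum>t\<in>T. card (?F t))"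
      using fin by (simp only:) (rule card_UN_disjoint, auto)
    then show ?thesis using k T by (simp add: subset_iff)
  qed
  have "{v \<in> S. ?f v \<in> permutations_of_set A} = S" using range by auto
  then have "card S = fact (card A) * k"
    using count[of "permutations_of_set A"] A(1) by simp
  then show ?thesis using count[OF C] by simp
qed

text \<open>Induction over the blocks: the words meeting the earlier conditions are stable under
  permutations of the new block, which is disjoint from the earlier ones, so the previous lemma
  supplies one more factor.\<close>

lemma card_prescribed_projections:
  assumes "finite F" "disjoint F" "\<And>A. A \<in> F \<Longrightarrow> finite A"
    "\<And>A x. A \<in> F \<Longrightarrow> x \<in> A \<Longrightarrow> count M x = 1"
    "\<And>A. A \<in> F \<Longrightarrow> C A \<subseteq> permutations_of_set A"
  shows "real (card {v \<in> permutations_of_multiset M. \<forall>A\<in>F. filter (\<lambda>x. x \<in> A) v \<in> C A}) =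
    real (card (permutations_of_multiset M)) * (\<Prod>A\<in>F. real (card (C A)) / fact (card A))"
  using assms
proof (induction F)
  case empty
  then show ?case by simp
next
  case (insert A F)
  define S where
    "S = {v \<in> permutations_of_multiset M. \<forall>B\<in>F. filter (\<lambda>x. x \<in> B) v \<in> C B}"
  have closed: "map \<pi> v \<in> S" if v: "v \<in> S" and \<pi>: "\<pi> permutes A" for v \<pi>
  proof -
    have "mset (map \<pi> v) = M"
      using v mset_map_permutes_simple[OF \<pi>, of M] insert.prems(3)
      by (auto simp: S_def permutations_of_multiset_def)
    \<comment> \<open>By disjointness \<open>\<pi>\<close> fixes the letters of \<open>B\<close> and
      moves no other letter into \<open>B\<close>.\<close>
    moreover have "filter (\<lambda>x. x \<in> B) (map \<pi> v) = filter (\<lambda>x. x \<in> B) v" if "B \<in> F" for B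
    proof -
      have "A \<inter> B = {}" using insert.hyps insert.prems(1) that by (auto simp: disjoint_def)
      then have "\<pi> x \<in> B \<longleftrightarrow> x \<in> B" "x \<in> B \<Longrightarrow> \<pi> x = x" for x
        using permutes_in_image[OF \<pi>, of x] permutes_not_in[OF \<pi>, of x] by (metis disjoint_iff)+
      moreover from this(2) have "map \<pi> (filter (\<lambda>x. x \<in> B) v) = filter (\<lambda>x. x \<in> B) v"
        by (intro map_idI) simp
      ultimately show ?thesis by (simp add: filter_map o_def)
    qed
    ultimately show ?thesis using v by (auto simp: S_def permutations_of_multiset_def)
  qed
  have card_S: "card {v \<in> S. filter (\<lambda>x. x \<in> A) v \<in> C A} * fact (card A) = card S * card (C A)"
  proof (rule card_prescribed_projection)
    show "S \<subseteq> permutations_of_multiset M" by (auto simp: S_def)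
    then show "finite S" by (rule finite_subset) simp
  qed (use closed insert.prems(2)[of A] insert.prems(3)[of A] insert.prems(4)[of A] in simp_all)
  have "real (card {v \<in> S. filter (\<lambda>x. x \<in> A) v \<in> C A}) * fact (card A) =
      real (card S) * real (card (C A))"
    using arg_cong[OF card_S, of real] by simp
  then have "real (card {v \<in> S. filter (\<lambda>x. x \<in> A) v \<in> C A}) =
      real (card S) * (real (card (C A)) / fact (card A))"
    by (simp add: field_simps)
  moreover have "{v \<in> permutations_of_multiset M. \<forall>B\<in>insert A F. filter (\<lambda>x. x \<in> B) v \<in> C B} =
      {v \<in> S. filter (\<lambda>x. x \<in> A) v \<in> C A}"
    by (auto simp: S_def)
  moreover have "real (card S) = real (card (permutations_of_multiset M)) *
      (\<Prod>A\<in>F. real (card (C A)) / fact (card A))"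
    unfolding S_def
  proof (rule insert.IH)
    show "disjoint F" using insert.prems(1) by (rule pairwise_subset) blast
  qed (use insert.prems(2-4) in blast)+
  ultimately show ?case using insert.hyps by simp
qed

theorem proposition5p4:
  fixes w :: "nat list"
  assumes "w \<in> words"
  shows "finite (join_taiga `` {w}) \<and>
    real (card (join_taiga `` {w})) =
      fact (length w) / (\<Prod>x\<in>set w. fact (count_list w x)) *
      (\<Prod>A\<in>max_simple_intervals w.
         real (hypoplactic_class_size (restrict_word w A)) / fact (card A))"
proof -
  let ?C = "\<lambda>A. trace_class (simple_covers (restrict_word w A)) (restrict_word w A)"
  have simple: "count (mset w) x = 1" if "A \<in> max_simple_intervals w" "x \<in> A" for A x
    using max_simple_intervals_simple[OF that(1)] that(2)
    by (auto simp: simple_letters_def count_mset)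
  have restr: "restrict_word w A \<in> permutations_of_set A"
    if A: "A \<in> max_simple_intervals w" for A
    using max_simple_intervals_simple[OF A] simple[OF A]
    by (auto simp: permutations_of_set_def restrict_word_def distinct_count_atmost_1)
  \<comment> \<open>The restricted word has no repeated letters, so its hypoplactic class is a
    trace.\<close>
  have hypo: "hypoplactic_class_size (restrict_word w A) = card (?C A)"
    if "A \<in> max_simple_intervals w" for A
    using restr[OF that] assms
    by (subst hypoplactic_class_size_def, subst hypoplactic_class_distinct)
      (auto simp: permutations_of_set_def words_def restrict_word_def)
  have sub: "?C A \<subseteq> permutations_of_set A" if "A \<in> max_simple_intervals w" for A
  proof
    fix v assume "v \<in> ?C A"
    then have m: "mset v = mset (restrict_word w A)" by (simp add: trace_class_def)
    show "v \<in> permutations_of_set A"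
      using restr[OF that] mset_eq_setD[OF m] mset_eq_imp_distinct_iff[OF m]
      by (simp add: permutations_of_set_def)
  qed
  have fin: "finite A" if "A \<in> max_simple_intervals w" for A
    using max_simple_intervals_simple[OF that] by (auto intro: finite_subset)
  \<comment> \<open>The multinomial coefficient; its division in \<open>nat\<close> is exact and so
    carries over to the reals.\<close>
  have total: "real (card (permutations_of_multiset (mset w))) =
      fact (length w) / (\<Prod>x\<in>set w. fact (count_list w x))"
    using card_permutations_of_multiset[of "mset w"]
    by (simp add: real_of_nat_div count_mset)
  have decomp: "join_taiga `` {w} = {v \<in> permutations_of_multiset (mset w).
      \<forall>A\<in>max_simple_intervals w. filter (\<lambda>x. x \<in> A) v \<in> ?C A}"
    using join_taiga_class[OF assms] trace_class_simple_covers_decompose by (rule trans)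
  have "real (card (join_taiga `` {w})) = real (card (permutations_of_multiset (mset w))) *
      (\<Prod>A\<in>max_simple_intervals w. real (card (?C A)) / fact (card A))"
    unfolding decomp
    by (intro card_prescribed_projections finite_max_simple_intervals
        disjoint_max_simple_intervals fin simple sub)
  moreover have "finite (join_taiga `` {w})"
    unfolding decomp by simp
  ultimately show ?thesis by (simp add: total hypo)
qed

end
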